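(* Let $x_0\in\mathsf X_0$. Suppose that for each $i\in\mathsf N$ the backward Riccati equation (RIC) of the context admits a solution $\{E_k^i,\ k\in\mathsf K\}$ of symmetric matrices (so that the matrices $Y_k^i=R_k^{ii}+{B_k^i}'E_{k+1}^iB_k^i$, $k\in\mathsf K_l$, $i\in\mathsf N$, are invertible). Let $\{x_k^\star,\lambda_k^i,\ k\in\mathsf K,\ \mu_k^{i\star},\ k\in\mathsf K_l,\ i\in\mathsf N\}$ be a solution of LCS1. Then, for every joint strategy $(\mathsf u^i,\mathsf u^{-i})\in R(x_0)$, the objective function of each player $i\in\mathsf N$ can be expressed as $$J^i(\mathsf u^i,\mathsf u^{-i})=V_0^i+\tfrac12\sum_{k\in\mathsf K_l}\|u_k^i+y_k^i\|_{Y_k^i}+\sum_{k\in\mathsf K_l}{\mu_k^{i\star}}'\big(M_k^ix_k+[N_k^i]_iu_k^i+\alpha_k^i+r_k^i\big),$$ where $y_k^i:=(Y_k^i)^{-1}{B_k^i}'E_{k+1}^iA_kx_k+b_k^i$, the sequence $\{x_k,\ k\in\mathsf K\}$ is the state trajectory generated by $(\mathsf u^i,\mathsf u^{-i})$ from $x_0$, and $V_0^i$, $b_k^i$, $\alpha_k^i$ are as defined in the context (for this joint strategy and these $\mu_k^{i\star}$).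
   Context: Notation. A prime denotes transpose; $\|a\|_A:=a'Aa$; $\mathrm{col}\{\cdot\}$ stacks vectors or matrices vertically; for vectors, $0\le x\perp y\ge0$ means $x\ge0$, $y\ge0$ (componentwise) and $x'y=0$. $\mathsf N=\{1,\dots,N\}$ (players), $\mathsf K=\{0,\dots,K\}$, $\mathsf K_l=\mathsf K\setminus\{K\}$, $-i=\mathsf N\setminus\{i\}$. The game (DGC). The state $x_k\in\mathbb R^n$ evolves as $x_{k+1}=A_kx_k+\sum_{i\in\mathsf N}B_k^iu_k^i$, $k\in\mathsf K_l$, with given $x_0\in\mathbb R^n$, where $A_k\in\mathbb R^{n\times n}$, $B_k^i\in\mathbb R^{n\times m_i}$ and $u_k^i\in\mathbb R^{m_i}$ is player $i$'s action. Put $\mathsf u_k=\mathrm{col}\{u_k^i\}_{i=1}^N\in\mathbb R^m$, $m=\sum_im_i$. Player $i$'s constraints are $M_k^ix_k+N_k^i\mathsf u_k+r_k^i\ge0$, $k\in\mathsf K_l$, with $M_k^i\in\mathbb R^{c_i\times n}$, $N_k^i\in\mathbb R^{c_i\times m}$, $r_k^i\in\mathbb R^{c_i}$; $[N_k^i]_j\in\mathbb R^{c_i\times m_j}$ is the block of columns of $N_k^i$ multiplying $u_k^j$. Player $i$'s strategy is $\mathsf u^i=\mathrm{col}\{u_k^i\}_{k=0}^{K-1}$, and $\mathsf u^{-i}$ collects the strategies of the other players. Player $i$ minimizes $$J^i(\mathsf u^i,\mathsf u^{-i})=\tfrac12\|x_K\|_{Q_K^i}+{p_K^i}'x_K+\tfrac12\sum_{k\in\mathsf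 K_l}\Big(\|x_k\|_{Q_k^i}+2{p_k^i}'x_k+\sum_{j\in\mathsf N}\|u_k^j\|_{R_k^{ij}}\Big),$$ with $Q_k^i\in\mathbb R^{n\times n}$ symmetric, $p_k^i\in\mathbb R^n$, $R_k^{ij}\in\mathbb R^{m_j\times m_j}$, $R_k^{ii}$ symmetric. The matrices $R_k^{ii}$ are positive definite. $R(x_0)$ is the set of joint strategies $(\mathsf u^i,\mathsf u^{-i})\in\mathbb R^{Km}$ for which, with the state generated from $x_0$, all players' constraints hold at all $k\in\mathsf K_l$; $\mathsf X_0=\{x_0\in\mathbb R^n: R(x_0)\ne\emptyset\}$. LCS1. A solution of LCS1 is a collection $\{x_k^\star,\lambda_k^i\in\mathbb R^n,\ k\in\mathsf K,\ \mu_k^{i\star}\in\mathbb R^{c_i},\ k\in\mathsf K_l,\ i\in\mathsf N\}$ such that for all $k\in\mathsf K_l$, $i\in\mathsf N$ $$x_{k+1}^\star=A_kx_k^\star-\sum_{j\in\mathsf N}B_k^j(R_k^{jj})^{-1}\big({B_k^j}'\lambda_{k+1}^j-[N_k^j]_j'\mu_k^{j\star}\big),$$ $$\lambda_k^i=Q_k^ix_k^\star+p_k^i+A_k'\lambda_{k+1}^i-{M_k^i}'\mu_k^{i\star},$$ $$0\le M_k^ix_k^\star-\sum_{j\in\mathsf N}[N_k^i]_j(R_k^{jj})^{-1}\big({B_k^j}'\lambda_{k+1}^j-[N_k^j]_j'\mu_k^{j\star}\big)+r_k^i\ \perp\ \mu_k^{i\star}\ge0,$$ with $x_0^\star=x_0$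 and $\lambda_K^i=Q_K^ix_K^\star+p_K^i$. Riccati equation (RIC). For $k\in\mathsf K_l$, $$E_k^i=A_k'E_{k+1}^iA_k+Q_k^i-A_k'E_{k+1}^iB_k^i(Y_k^i)^{-1}{B_k^i}'E_{k+1}^iA_k,\quad E_K^i=Q_K^i,\quad Y_k^i=R_k^{ii}+{B_k^i}'E_{k+1}^iB_k^i.$$ Backward recursions. Given a joint strategy and the $\mu_k^{i\star}$, put $\eta_k^i=\sum_{j\in-i}B_k^ju_k^j$, $\alpha_k^i=\sum_{j\in-i}[N_k^i]_ju_k^j$, and define for $k\in\mathsf K_l$ $$Y_k^ib_k^i={B_k^i}'(E_{k+1}^i\eta_k^i+e_{k+1}^i)-[N_k^i]_i'\mu_k^{i\star},$$ $$e_k^i=A_k'e_{k+1}^i+A_k'E_{k+1}^i\eta_k^i-A_k'E_{k+1}^iB_k^ib_k^i+p_k^i-{M_k^i}'\mu_k^{i\star},$$ $$f_k^i=f_{k+1}^i+\tfrac12{\eta_k^i}'(E_{k+1}^i\eta_k^i+2e_{k+1}^i)+\tfrac12\sum_{j\in-i}\|u_k^j\|_{R_k^{ij}}-\tfrac12\|b_k^i\|_{Y_k^i}-{\mu_k^{i\star}}'(\alpha_k^i+r_k^i),$$ with $e_K^i=p_K^i$, $b_K^i=0$, $f_K^i=0$. Finally $V_k^i=\tfrac12\|x_k\|_{E_k^i}+{e_k^i}'x_k+f_k^i$. *)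

theory Defs
  imports "Jordan_Normal_Form.Gauss_Jordan_Elimination"
begin

text \<open>The action and constraint dimensions depend on the player, so vectors and matrices
  have explicit carriers; a player index always precedes the time index. Data with index
  outside \<open>players\<close> or beyond the horizon is never constrained and never used.\<close>

record dgc =
  num_players :: nat
  horizon :: nat
  state_dim :: nat
  act_dim :: "nat \<Rightarrow> nat"
  con_dim :: "nat \<Rightarrow> nat"
  Amat :: "nat \<Rightarrow> real mat"
  Bmat :: "nat \<Rightarrow> nat \<Rightarrow> real mat"
  Mmat :: "nat \<Rightarrow> nat \<Rightarrow> real mat"
  Nmat :: "nat \<Rightarrow> nat \<Rightarrow> real mat"
  rvec :: "nat \<Rightarrow> nat \<Rightarrow> real vec"
  Qmat :: "nat \<Rightarrow> nat \<Rightarrow> real mat"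
  pvec :: "nat \<Rightarrow> nat \<Rightarrow> real vec"
  Rmat :: "nat \<Rightarrow> nat \<Rightarrow> nat \<Rightarrow> real mat"  \<comment> \<open>\<open>Rmat G i j k\<close> is $R^{ij}_k$\<close>

definition players :: "dgc \<Rightarrow> nat set" where
  "players G = {1..num_players G}"

definition total_act_dim :: "dgc \<Rightarrow> nat" where
  "total_act_dim G = (\<Sum>i\<in>players G. act_dim G i)"

definition sym_mat :: "real mat \<Rightarrow> bool" where
  "sym_mat A \<longleftrightarrow> transpose_mat A = A"

text \<open>The weighted square written $\|a\|_A$, without a square root.\<close>

definition qform :: "real mat \<Rightarrow> real vec \<Rightarrow> real" where
  "qform A a = a \<bullet> (A *\<^sub>v a)"

definition pos_def :: "nat \<Rightarrow> real mat \<Rightarrow> bool" where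
  "pos_def d A \<longleftrightarrow> (\<forall>v\<in>carrier_vec d. v \<noteq> 0\<^sub>v d \<longrightarrow> qform A v > 0)"

text \<open>Meaningful for invertible matrices only.\<close>

definition mat_inv :: "real mat \<Rightarrow> real mat" where
  "mat_inv A = the (mat_inverse A)"

lemma mat_inv:
  assumes A: "A \<in> carrier_mat d d" and inv: "invertible_mat A"
  shows "mat_inv A \<in> carrier_mat d d" "A * mat_inv A = 1\<^sub>m d" "mat_inv A * A = 1\<^sub>m d"
proof -
  obtain B where B: "inverts_mat A B" "inverts_mat B A"
    using inv by (auto simp: invertible_mat_def)
  have AB: "A * B = 1\<^sub>m d" and BA: "B * A = 1\<^sub>m (dim_row B)"
    using A B by (auto simp: inverts_mat_def)
  have "dim_col (A * B) = d" "dim_col (B * A) = dim_row B"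
    by (simp_all add: AB BA)
  then have Bc: "B \<in> carrier_mat d d" using A by auto
  have "A \<in> Units (ring_mat TYPE(real) d ())"
    using A Bc AB BA by (auto simp: Units_def ring_mat_def)
  then obtain C where C: "mat_inverse A = Some C"
    using mat_inverse(1)[OF A, of "()"] by (cases "mat_inverse A") auto
  show "mat_inv A \<in> carrier_mat d d" "A * mat_inv A = 1\<^sub>m d" "mat_inv A * A = 1\<^sub>m d"
    using mat_inverse(2)[OF A C] C by (simp_all add: mat_inv_def)
qed

definition dgc_game :: "dgc \<Rightarrow> bool" where
  "dgc_game G \<longleftrightarrow>
     (let n = state_dim G; K = horizon G in
       (\<forall>k<K. Amat G k \<in> carrier_mat n n) \<and>
       (\<forall>i\<in>players G. \<forall>k<K.
          Bmat G i k \<in> carrier_mat n (act_dim G i) \<and>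
          Mmat G i k \<in> carrier_mat (con_dim G i) n \<and>
          Nmat G i k \<in> carrier_mat (con_dim G i) (total_act_dim G) \<and>
          rvec G i k \<in> carrier_vec (con_dim G i) \<and>
          (\<forall>j\<in>players G. Rmat G i j k \<in> carrier_mat (act_dim G j) (act_dim G j)) \<and>
          sym_mat (Rmat G i i k) \<and> pos_def (act_dim G i) (Rmat G i i k)) \<and>
       (\<forall>i\<in>players G. \<forall>k\<le>K.
          Qmat G i k \<in> carrier_mat n n \<and> sym_mat (Qmat G i k) \<and>
          pvec G i k \<in> carrier_vec n))"

text \<open>The block of columns of $N^i_k$ that multiplies player \<open>j\<close>'s action.\<close>

definition Nblock :: "dgc \<Rightarrow> nat \<Rightarrow> nat \<Rightarrow> nat \<Rightarrow> real mat" where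
  "Nblock G i j k =
     mat (con_dim G i) (act_dim G j)
       (\<lambda>(r, s). Nmat G i k $$ (r, (\<Sum>l=1..<j. act_dim G l) + s))"

text \<open>A joint strategy is a family \<open>u\<close> in which \<open>u i k\<close> is player \<open>i\<close>'s action at time \<open>k\<close>.\<close>

type_synonym strategy = "nat \<Rightarrow> nat \<Rightarrow> real vec"

definition stacked :: "dgc \<Rightarrow> strategy \<Rightarrow> nat \<Rightarrow> real vec" where
  "stacked G u k = vec_of_list (concat (map (\<lambda>i. list_of_vec (u i k)) [1..<Suc (num_players G)]))"

definition state_sum :: "dgc \<Rightarrow> (nat \<Rightarrow> real vec) \<Rightarrow> nat set \<Rightarrow> real vec" where
  "state_sum G = finsum_vec TYPE(real) (state_dim G)"

definition con_sum :: "dgc \<Rightarrow> nat \<Rightarrow> (nat \<Rightarrow> real vec) \<Rightarrow> nat set \<Rightarrow> real vec" where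
  "con_sum G i = finsum_vec TYPE(real) (con_dim G i)"

fun state :: "dgc \<Rightarrow> real vec \<Rightarrow> strategy \<Rightarrow> nat \<Rightarrow> real vec" where
  "state G x0 u 0 = x0"
| "state G x0 u (Suc k) =
     Amat G k *\<^sub>v state G x0 u k + state_sum G (\<lambda>i. Bmat G i k *\<^sub>v u i k) (players G)"

definition objective :: "dgc \<Rightarrow> real vec \<Rightarrow> nat \<Rightarrow> strategy \<Rightarrow> real" where
  "objective G x0 i u =
     (let K = horizon G; x = state G x0 u in
       1/2 * qform (Qmat G i K) (x K) + pvec G i K \<bullet> x K +
       1/2 * (\<Sum>k<K. qform (Qmat G i k) (x k) + 2 * (pvec G i k \<bullet> x k)
                     + (\<Sum>j\<in>players G. qform (Rmat G i j k) (u j k))))"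

definition feasible :: "dgc \<Rightarrow> real vec \<Rightarrow> strategy set" where
  "feasible G x0 =
     {u. (\<forall>i\<in>players G. \<forall>k<horizon G. u i k \<in> carrier_vec (act_dim G i)) \<and>
         (\<forall>i\<in>players G. \<forall>k<horizon G.
            Mmat G i k *\<^sub>v state G x0 u k + Nmat G i k *\<^sub>v stacked G u k + rvec G i k
              \<ge> 0\<^sub>v (con_dim G i))}"

definition X0 :: "dgc \<Rightarrow> real vec set" where
  "X0 G = {x0 \<in> carrier_vec (state_dim G). feasible G x0 \<noteq> {}}"

text \<open>The action $-(R^{jj}_k)^{-1}({B^j_k}'\lambda^j_{k+1} - [N^j_k]_j'\mu^j_k)$ occurs in LCS1
  without its sign.\<close>

definition lcs_act :: "dgc \<Rightarrow> (nat \<Rightarrow> nat \<Rightarrow> real vec) \<Rightarrow> (nat \<Rightarrow> nat \<Rightarrow> real vec) \<Rightarrow> nat \<Rightarrow> nat \<Rightarrow> real vec" where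
  "lcs_act G lam mu j k =
     mat_inv (Rmat G j j k) *\<^sub>v
       (transpose_mat (Bmat G j k) *\<^sub>v lam j (Suc k) - transpose_mat (Nblock G j j k) *\<^sub>v mu j k)"

definition perp_nonneg :: "nat \<Rightarrow> real vec \<Rightarrow> real vec \<Rightarrow> bool" where
  "perp_nonneg d x y \<longleftrightarrow> 0\<^sub>v d \<le> x \<and> x \<bullet> y = 0 \<and> 0\<^sub>v d \<le> y"

definition LCS1_solution ::
  "dgc \<Rightarrow> real vec \<Rightarrow> (nat \<Rightarrow> real vec) \<Rightarrow> (nat \<Rightarrow> nat \<Rightarrow> real vec) \<Rightarrow> (nat \<Rightarrow> nat \<Rightarrow> real vec) \<Rightarrow> bool" where
  "LCS1_solution G x0 x lam mu \<longleftrightarrow>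
     (let n = state_dim G; K = horizon G in
       (\<forall>k\<le>K. x k \<in> carrier_vec n) \<and>
       (\<forall>i\<in>players G. \<forall>k\<le>K. lam i k \<in> carrier_vec n) \<and>
       (\<forall>i\<in>players G. \<forall>k<K. mu i k \<in> carrier_vec (con_dim G i)) \<and>
       x 0 = x0 \<and>
       (\<forall>i\<in>players G. lam i K = Qmat G i K *\<^sub>v x K + pvec G i K) \<and>
       (\<forall>k<K. x (Suc k) = Amat G k *\<^sub>v x k
                 - state_sum G (\<lambda>j. Bmat G j k *\<^sub>v lcs_act G lam mu j k) (players G)) \<and>
       (\<forall>i\<in>players G. \<forall>k<K.
          lam i k = Qmat G i k *\<^sub>v x k + pvec G i k + transpose_mat (Amat G k) *\<^sub>v lam i (Suc k)
                      - transpose_mat (Mmat G i k) *\<^sub>v mu i k \<and>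
          perp_nonneg (con_dim G i)
            (Mmat G i k *\<^sub>v x k
               - con_sum G i (\<lambda>j. Nblock G i j k *\<^sub>v lcs_act G lam mu j k) (players G) + rvec G i k)
            (mu i k)))"

text \<open>Below, \<open>E i k\<close> stands for $E^i_k$.\<close>

definition Ymat :: "dgc \<Rightarrow> (nat \<Rightarrow> nat \<Rightarrow> real mat) \<Rightarrow> nat \<Rightarrow> nat \<Rightarrow> real mat" where
  "Ymat G E i k = Rmat G i i k + transpose_mat (Bmat G i k) * E i (Suc k) * Bmat G i k"

definition RIC_solution :: "dgc \<Rightarrow> (nat \<Rightarrow> nat \<Rightarrow> real mat) \<Rightarrow> nat \<Rightarrow> bool" where
  "RIC_solution G E i \<longleftrightarrow>
     (\<forall>k\<le>horizon G. E i k \<in> carrier_mat (state_dim G) (state_dim G)) \<and>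
     E i (horizon G) = Qmat G i (horizon G) \<and>
     (\<forall>k<horizon G. invertible_mat (Ymat G E i k) \<and>
        (let A = Amat G k; B = Bmat G i k; E' = E i (Suc k) in
          E i k = transpose_mat A * E' * A + Qmat G i k
            - transpose_mat A * E' * B * mat_inv (Ymat G E i k) * transpose_mat B * E' * A))"

definition eta :: "dgc \<Rightarrow> strategy \<Rightarrow> nat \<Rightarrow> nat \<Rightarrow> real vec" where
  "eta G u i k = state_sum G (\<lambda>j. Bmat G j k *\<^sub>v u j k) (players G - {i})"

definition alpha :: "dgc \<Rightarrow> strategy \<Rightarrow> nat \<Rightarrow> nat \<Rightarrow> real vec" where
  "alpha G u i k = con_sum G i (\<lambda>j. Nblock G i j k *\<^sub>v u j k) (players G - {i})"

text \<open>$b^i_k$ as a function of the value \<open>e'\<close> of $e^i_{k+1}$: the solution of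
  $Y^i_k b = {B^i_k}'(E^i_{k+1}\eta^i_k + e') - [N^i_k]_i'\mu^i_k$.\<close>

definition b_of :: "dgc \<Rightarrow> (nat \<Rightarrow> nat \<Rightarrow> real mat) \<Rightarrow> strategy \<Rightarrow> (nat \<Rightarrow> nat \<Rightarrow> real vec) \<Rightarrow>
    nat \<Rightarrow> nat \<Rightarrow> real vec \<Rightarrow> real vec" where
  "b_of G E u mu i k e' =
     mat_inv (Ymat G E i k) *\<^sub>v
       (transpose_mat (Bmat G i k) *\<^sub>v (E i (Suc k) *\<^sub>v eta G u i k + e')
          - transpose_mat (Nblock G i i k) *\<^sub>v mu i k)"

lemma b_of_eq:
  fixes G E u mu i k e'
  defines "rhs \<equiv> transpose_mat (Bmat G i k) *\<^sub>v (E i (Suc k) *\<^sub>v eta G u i k + e')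
                    - transpose_mat (Nblock G i i k) *\<^sub>v mu i k"
  assumes Y: "Ymat G E i k \<in> carrier_mat (act_dim G i) (act_dim G i)" "invertible_mat (Ymat G E i k)"
  shows "Ymat G E i k *\<^sub>v b_of G E u mu i k e' = rhs"
proof -
  have "rhs \<in> carrier_vec (act_dim G i)"
    by (intro carrier_vecI) (simp add: rhs_def Nblock_def)
  then show ?thesis
    using mat_inv[OF Y] Y(1)
    by (simp add: b_of_def rhs_def[symmetric] flip: assoc_mult_mat_vec)
qed

function e_vec :: "dgc \<Rightarrow> (nat \<Rightarrow> nat \<Rightarrow> real mat) \<Rightarrow> strategy \<Rightarrow> (nat \<Rightarrow> nat \<Rightarrow> real vec) \<Rightarrow>
    nat \<Rightarrow> nat \<Rightarrow> real vec" where
  "e_vec G E u mu i k =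
     (if k < horizon G then
        (let At = transpose_mat (Amat G k); E' = E i (Suc k); e' = e_vec G E u mu i (Suc k) in
          At *\<^sub>v e' + At *\<^sub>v (E' *\<^sub>v eta G u i k)
            - At *\<^sub>v (E' *\<^sub>v (Bmat G i k *\<^sub>v b_of G E u mu i k e'))
            + pvec G i k - transpose_mat (Mmat G i k) *\<^sub>v mu i k)
      else pvec G i (horizon G))"
  by pat_completeness auto
termination
  by (relation "measure (\<lambda>(G, E, u, mu, i, k). horizon G - k)") auto

declare e_vec.simps [simp del]

definition b_vec :: "dgc \<Rightarrow> (nat \<Rightarrow> nat \<Rightarrow> real mat) \<Rightarrow> strategy \<Rightarrow> (nat \<Rightarrow> nat \<Rightarrow> real vec) \<Rightarrow>
    nat \<Rightarrow> nat \<Rightarrow> real vec" where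
  "b_vec G E u mu i k =
     (if k < horizon G then b_of G E u mu i k (e_vec G E u mu i (Suc k)) else 0\<^sub>v (act_dim G i))"

function f_val :: "dgc \<Rightarrow> (nat \<Rightarrow> nat \<Rightarrow> real mat) \<Rightarrow> strategy \<Rightarrow> (nat \<Rightarrow> nat \<Rightarrow> real vec) \<Rightarrow>
    nat \<Rightarrow> nat \<Rightarrow> real" where
  "f_val G E u mu i k =
     (if k < horizon G then
        f_val G E u mu i (Suc k)
        + 1/2 * (eta G u i k \<bullet> (E i (Suc k) *\<^sub>v eta G u i k + 2 \<cdot>\<^sub>v e_vec G E u mu i (Suc k)))
        + 1/2 * (\<Sum>j\<in>players G - {i}. qform (Rmat G i j k) (u j k))
        - 1/2 * qform (Ymat G E i k) (b_vec G E u mu i k)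
        - mu i k \<bullet> (alpha G u i k + rvec G i k)
      else 0)"
  by pat_completeness auto
termination
  by (relation "measure (\<lambda>(G, E, u, mu, i, k). horizon G - k)") auto

declare f_val.simps [simp del]

definition V_val :: "dgc \<Rightarrow> real vec \<Rightarrow> (nat \<Rightarrow> nat \<Rightarrow> real mat) \<Rightarrow> strategy \<Rightarrow> (nat \<Rightarrow> nat \<Rightarrow> real vec) \<Rightarrow>
    nat \<Rightarrow> nat \<Rightarrow> real" where
  "V_val G x0 E u mu i k =
     1/2 * qform (E i k) (state G x0 u k) + e_vec G E u mu i k \<bullet> state G x0 u k + f_val G E u mu i k"

definition y_vec :: "dgc \<Rightarrow> real vec \<Rightarrow> (nat \<Rightarrow> nat \<Rightarrow> real mat) \<Rightarrow> strategy \<Rightarrow> (nat \<Rightarrow> nat \<Rightarrow> real vec) \<Rightarrow>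
    nat \<Rightarrow> nat \<Rightarrow> real vec" where
  "y_vec G x0 E u mu i k =
     (mat_inv (Ymat G E i k) * transpose_mat (Bmat G i k) * E i (Suc k) * Amat G k) *\<^sub>v state G x0 u k
       + b_vec G E u mu i k"

end

theory Submission
  imports Defs
begin

text \<open>Substituting the dynamics into $V^i_{k+1}$ makes it quadratic in $u^i_k$. Completing the square
  shows that $V^i_{k+1}$ plus the stage cost is $V^i_k$ plus the $k$-th terms of the two sums; the
  recursions for $E$, $e$, $b$ and $f$ are exactly what this identity requires. Since $V^i_K$ is
  the terminal cost, the claim follows by telescoping.\<close>

lemma sym_mat_scalar_prod_commute:
  assumes "sym_mat A" "A \<in> carrier_mat n n" "v \<in> carrier_vec n" "w \<in> carrier_vec n"
  shows "v \<bullet> (A *\<^sub>v w) = w \<bullet> (A *\<^sub>v v)"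
  using transpose_vec_mult_scalar[of A n n w v] assms comm_scalar_prod[of "A *\<^sub>v v" n w]
  by (simp add: sym_mat_def)

lemma qform_add:
  assumes "sym_mat A" "A \<in> carrier_mat n n" "v \<in> carrier_vec n" "w \<in> carrier_vec n"
  shows "qform A (v + w) = qform A v + 2 * (v \<bullet> (A *\<^sub>v w)) + qform A w"
  using assms sym_mat_scalar_prod_commute[OF assms]
  by (simp add: qform_def mult_add_distrib_mat_vec[of _ n n]
      scalar_prod_add_distrib[of _ n] add_scalar_prod_distrib[of _ n])

text \<open>The adjoint rule, oriented so that the transpose disappears and the matrix ends up in
  the right factor; the products in the stage identity are brought to this shape so that equal terms
  can cancel.\<close>

lemma scalar_prod_transpose_mult:
  fixes A :: "real mat"
  assumes "A \<in> carrier_mat m n" "x \<in> carrier_vec n" "y \<in> carrier_vec m"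
  shows "x \<bullet> (transpose_mat A *\<^sub>v y) = y \<bullet> (A *\<^sub>v x)"
  using transpose_vec_mult_scalar[of A m n x y] comm_scalar_prod[of x n "transpose_mat A *\<^sub>v y"] assms
  by simp

text \<open>One stage for one player, with indices stripped: \<open>E\<close>, \<open>e\<close>
  belong to time k+1, \<open>E\<^sub>0\<close>, \<open>e\<^sub>0\<close> to time k, and
  \<open>a\<close> is \<alpha> plus r. The other players' control costs and the value of f at k+1
  occur identically on both sides and are left out. The multiplier terms built into
  \<open>b\<close>, \<open>e\<^sub>0\<close> and \<open>- \<mu> \<bullet> a\<close> cancel the last
  summand, so the identity holds for every \<mu>.\<close>

lemma complete_square:
  fixes A B E E\<^sub>0 M N Q R Y W :: "real mat" and x \<eta> e p u \<mu> a b e\<^sub>0 y x\<^sub>1 :: "real vec"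
  assumes [simp]: "A \<in> carrier_mat n n" "B \<in> carrier_mat n d" "E \<in> carrier_mat n n"
      "M \<in> carrier_mat c n" "N \<in> carrier_mat c d" "Q \<in> carrier_mat n n" "R \<in> carrier_mat d d"
      "W \<in> carrier_mat d d"
      "x \<in> carrier_vec n" "\<eta> \<in> carrier_vec n" "e \<in> carrier_vec n" "p \<in> carrier_vec n"
      "u \<in> carrier_vec d" "b \<in> carrier_vec d" "\<mu> \<in> carrier_vec c" "a \<in> carrier_vec c"
    and symE: "sym_mat E" and symR: "sym_mat R"
    and Y: "Y = R + transpose_mat B * E * B" and YW: "Y * W = 1\<^sub>m d"
    and b: "Y *\<^sub>v b = transpose_mat B *\<^sub>v (E *\<^sub>v \<eta> + e) - transpose_mat N *\<^sub>v \<mu>"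
    and y: "y = (W * transpose_mat B * E * A) *\<^sub>v x + b"
    and E0: "E\<^sub>0 = transpose_mat A * E * A + Q
              - transpose_mat A * E * B * W * transpose_mat B * E * A"
    and e0: "e\<^sub>0 = transpose_mat A *\<^sub>v e + transpose_mat A *\<^sub>v (E *\<^sub>v \<eta>)
              - transpose_mat A *\<^sub>v (E *\<^sub>v (B *\<^sub>v b)) + p - transpose_mat M *\<^sub>v \<mu>"
    and x1: "x\<^sub>1 = A *\<^sub>v x + (B *\<^sub>v u + \<eta>)"
  shows "1/2 * qform E x\<^sub>1 + e \<bullet> x\<^sub>1 + 1/2 * qform Q x + p \<bullet> x + 1/2 * qform R u =
     1/2 * qform E\<^sub>0 x + e\<^sub>0 \<bullet> x + 1/2 * (\<eta> \<bullet> (E *\<^sub>v \<eta> + 2 \<cdot>\<^sub>v e)) - 1/2 * qform Y b - \<mu> \<bullet> a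
     + 1/2 * qform Y (u + y) + \<mu> \<bullet> (M *\<^sub>v x + N *\<^sub>v u + a)"
proof -
  \<comment> \<open>\<open>z\<close> is the uncontrolled drift and \<open>v\<close> the
    state-feedback part of \<open>y\<close>, so that \<open>y = v + b\<close>. All terms are
    rewritten through these two vectors, which removes the inverse \<open>W\<close> from the
    computation.\<close>
  define z where "z = A *\<^sub>v x"
  define v where "v = W *\<^sub>v (transpose_mat B *\<^sub>v (E *\<^sub>v z))"
  \<comment> \<open>The inner dimension of a product is absent from the conclusions of these carrier
    rules, so the simplifier needs instances for the dimensions that occur.\<close>
  note [simp] = mult_mat_vec_carrier[of _ n n] mult_mat_vec_carrier[of _ n d]
    mult_mat_vec_carrier[of _ d n] mult_mat_vec_carrier[of _ d d] mult_mat_vec_carrier[of _ n c]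
    mult_mat_vec_carrier[of _ c n] mult_mat_vec_carrier[of _ c d] mult_mat_vec_carrier[of _ d c]
    mult_carrier_mat[of _ n n] mult_carrier_mat[of _ n d]
    mult_carrier_mat[of _ d n] mult_carrier_mat[of _ d d]
  have [simp]: "z \<in> carrier_vec n" "v \<in> carrier_vec d" "Y \<in> carrier_mat d d"
    by (simp_all add: v_def z_def Y)
  have symY: "sym_mat Y"
  proof -
    have "transpose_mat (transpose_mat B * E * B) = transpose_mat B * (transpose_mat E * B)"
      by (simp add: transpose_mult[of _ d n _ d] transpose_mult[of _ d n _ n])
    also have "\<dots> = transpose_mat B * E * B"
      using symE by (simp add: sym_mat_def assoc_mult_mat[of _ d n _ n _ d])
    finally have "transpose_mat (transpose_mat B * E * B) = transpose_mat B * E * B" .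
    moreover have "transpose_mat B * E * B \<in> carrier_mat d d"
      by simp
    ultimately show ?thesis
      using symR transpose_add[of R d d "transpose_mat B * E * B"] by (simp add: sym_mat_def Y)
  qed
  have Yv: "Y *\<^sub>v v = transpose_mat B *\<^sub>v (E *\<^sub>v z)"
    unfolding v_def using YW assoc_mult_mat_vec[of Y d d W d "transpose_mat B *\<^sub>v (E *\<^sub>v z)"] by simp
  have y': "y = v + b"
    by (simp add: y v_def z_def assoc_mult_mat_vec[of _ d n _ n] assoc_mult_mat_vec[of _ d d _ n])
  have vYv: "qform Y v = z \<bullet> (E *\<^sub>v (B *\<^sub>v v))"
    using sym_mat_scalar_prod_commute[OF symE, of n z "B *\<^sub>v v"]
      scalar_prod_transpose_mult[of B n d v "E *\<^sub>v z"] comm_scalar_prod[of "E *\<^sub>v z" n "B *\<^sub>v v"]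
    by (simp add: qform_def Yv)
  \<comment> \<open>The correction term of the Riccati equation, evaluated at \<open>x\<close>, is
    exactly the square of \<open>v\<close> weighted by \<open>Y\<close>; it cancels the same square
    inside the completed square.\<close>
  have E0x: "qform E\<^sub>0 x = qform E z + qform Q x - qform Y v"
  proof -
    have "E\<^sub>0 *\<^sub>v x = transpose_mat A *\<^sub>v (E *\<^sub>v z) + Q *\<^sub>v x - transpose_mat A *\<^sub>v (E *\<^sub>v (B *\<^sub>v v))"
      by (simp add: E0 v_def z_def minus_mult_distrib_mat_vec[of _ n n] add_mult_distrib_mat_vec[of _ n n]
          assoc_mult_mat_vec[of _ n n _ n] assoc_mult_mat_vec[of _ n d _ n] assoc_mult_mat_vec[of _ n d _ d]
          assoc_mult_mat_vec[of _ n n _ d])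
    then show ?thesis
      unfolding vYv
      by (simp add: qform_def scalar_prod_minus_distrib[of _ n] scalar_prod_add_distrib[of _ n]
          scalar_prod_transpose_mult[of A n n] comm_scalar_prod[of "A *\<^sub>v x" n] flip: z_def)
        (simp add: comm_scalar_prod[of _ n z])
  qed
  have e0x: "e\<^sub>0 \<bullet> x = e \<bullet> z + z \<bullet> (E *\<^sub>v \<eta>) - z \<bullet> (E *\<^sub>v (B *\<^sub>v b)) + p \<bullet> x - \<mu> \<bullet> (M *\<^sub>v x)"
    by (simp add: e0 minus_scalar_prod_distrib[of _ n] add_scalar_prod_distrib[of _ n]
        transpose_vec_mult_scalar[of A n n] transpose_vec_mult_scalar[of M c n] flip: z_def)
      (simp add: comm_scalar_prod[of _ n z])
  \<comment> \<open>The equation defining \<open>b\<close>, paired with \<open>u\<close>, produces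
    the terms linear in \<open>u\<close> that involve \<eta>, \<open>e\<close> and \<mu>; those with
    \<open>z\<close> come from \<open>v\<close>.\<close>
  have uYb: "u \<bullet> (Y *\<^sub>v b) = (B *\<^sub>v u) \<bullet> (E *\<^sub>v \<eta>) + e \<bullet> (B *\<^sub>v u) - \<mu> \<bullet> (N *\<^sub>v u)"
    unfolding b
    by (simp add: scalar_prod_minus_distrib[of _ d] scalar_prod_transpose_mult[of B n d]
        scalar_prod_transpose_mult[of N c d] add_scalar_prod_distrib[of _ n]
        comm_scalar_prod[of "E *\<^sub>v \<eta>" n])
  \<comment> \<open>Stated for arbitrary \<open>w\<close> because the expansion of the completed
    square needs it for both \<open>u\<close> and \<open>b\<close>.\<close>
  have wYv: "w \<bullet> (Y *\<^sub>v v) = z \<bullet> (E *\<^sub>v (B *\<^sub>v w))" if [simp]: "w \<in> carrier_vec d" for w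
    unfolding Yv
    using sym_mat_scalar_prod_commute[OF symE, of n z "B *\<^sub>v w"]
    by (simp add: scalar_prod_transpose_mult[of B n d] comm_scalar_prod[of "E *\<^sub>v z" n])
  have uYu: "qform Y u = qform R u + qform E (B *\<^sub>v u)"
    by (simp add: qform_def Y add_mult_distrib_mat_vec[of _ d d] scalar_prod_add_distrib[of _ d]
        assoc_mult_mat_vec[of _ d n _ d] assoc_mult_mat_vec[of _ d n _ n]
        scalar_prod_transpose_mult[of B n d] comm_scalar_prod[of "B *\<^sub>v u" n])
  have x1': "qform E x\<^sub>1 = qform E z + 2 * (z \<bullet> (E *\<^sub>v (B *\<^sub>v u)) + z \<bullet> (E *\<^sub>v \<eta>))
      + (qform E (B *\<^sub>v u) + 2 * ((B *\<^sub>v u) \<bullet> (E *\<^sub>v \<eta>)) + qform E \<eta>)"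
    by (simp add: x1 qform_add[OF symE, of n] mult_add_distrib_mat_vec[of _ n n]
        scalar_prod_add_distrib[of _ n] flip: z_def)
  have ex1: "e \<bullet> x\<^sub>1 = e \<bullet> z + e \<bullet> (B *\<^sub>v u) + e \<bullet> \<eta>"
    by (simp add: x1 scalar_prod_add_distrib[of _ n] flip: z_def)
  have uy: "qform Y (u + y) = qform Y u + 2 * (z \<bullet> (E *\<^sub>v (B *\<^sub>v u)) + u \<bullet> (Y *\<^sub>v b))
      + (qform Y v + 2 * (z \<bullet> (E *\<^sub>v (B *\<^sub>v b))) + qform Y b)"
    using sym_mat_scalar_prod_commute[OF symY, of d v b]
    by (simp add: y' qform_add[OF symY, of d] mult_add_distrib_mat_vec[of _ d d]
        scalar_prod_add_distrib[of _ d] wYv)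
  have \<eta>: "\<eta> \<bullet> (E *\<^sub>v \<eta> + 2 \<cdot>\<^sub>v e) = qform E \<eta> + 2 * (e \<bullet> \<eta>)"
    by (simp add: qform_def scalar_prod_add_distrib[of _ n] scalar_prod_smult_distrib[of _ n]
        comm_scalar_prod[of \<eta> n e])
  have \<mu>: "\<mu> \<bullet> (M *\<^sub>v x + N *\<^sub>v u + a) = \<mu> \<bullet> (M *\<^sub>v x) + \<mu> \<bullet> (N *\<^sub>v u) + \<mu> \<bullet> a"
    by (simp add: scalar_prod_add_distrib[of _ c])
  \<comment> \<open>After these rewrites the two sides are linear combinations of the same scalar
    products, and only real arithmetic remains.\<close>
  show ?thesis
    unfolding x1' ex1 E0x e0x uy uYu uYb \<eta> \<mu> by (simp add: algebra_simps)
qed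

text \<open>Separates a player's own input from the dynamics; what is left of the sum is
  \<open>eta\<close>.\<close>

lemma finsum_vec_remove:
  fixes f :: "'b \<Rightarrow> 'a::comm_monoid_add vec"
  assumes "finite S" "i \<in> S" "\<And>j. j \<in> S \<Longrightarrow> f j \<in> carrier_vec n"
  shows "finsum_vec TYPE('a) n f S = f i + finsum_vec TYPE('a) n f (S - {i})"
proof -
  have "finsum_vec TYPE('a) n f (insert i (S - {i})) = f i + finsum_vec TYPE('a) n f (S - {i})"
    using assms by (intro finsum_vec_insert) auto
  then show ?thesis using assms(2) by (simp add: insert_absorb)
qed

context
  fixes G :: dgc
  assumes game: "dgc_game G"
begin

lemma state_carrier:
  assumes "x0 \<in> carrier_vec (state_dim G)"
    and u: "\<forall>i\<in>players G. \<forall>k<horizon G. u i k \<in> carrier_vec (act_dim G i)"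
    and "k \<le> horizon G"
  shows "state G x0 u k \<in> carrier_vec (state_dim G)"
  using assms(3)
proof (induction k)
  case 0
  then show ?case using assms(1) by simp
next
  case (Suc k)
  then have "Bmat G i k *\<^sub>v u i k \<in> carrier_vec (state_dim G)" if "i \<in> players G" for i
    using that game u by (intro mult_mat_vec_carrier[of _ _ "act_dim G i"]) (auto simp: dgc_game_def Let_def)
  then have "state_sum G (\<lambda>i. Bmat G i k *\<^sub>v u i k) (players G) \<in> carrier_vec (state_dim G)"
    unfolding state_sum_def by (intro finsum_vec_closed) auto
  moreover have "Amat G k \<in> carrier_mat (state_dim G) (state_dim G)"
    using game Suc.prems by (auto simp: dgc_game_def Let_def)
  ultimately show ?case using Suc by (auto intro!: add_carrier_vec mult_mat_vec_carrier)
qed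

lemma e_vec_carrier:
  assumes "i \<in> players G" "k \<le> horizon G"
  shows "e_vec G E u mu i k \<in> carrier_vec (state_dim G)"
proof (cases "k < horizon G")
  case True
  \<comment> \<open>A vector sum or difference takes its dimension from its right operand, so the
    last summand of the recursion alone fixes the dimension of \<open>e_vec\<close>.\<close>
  then have "Mmat G i k \<in> carrier_mat (con_dim G i) (state_dim G)"
    using game assms by (auto simp: dgc_game_def Let_def)
  then show ?thesis
    using True by (intro carrier_vecI) (simp add: e_vec.simps[of G E u mu i k] Let_def)
next
  case False
  then show ?thesis
    using game assms by (simp add: e_vec.simps[of G E u mu i "horizon G"] dgc_game_def Let_def)
qed

text \<open>A Bellman-type identity along the trajectory of an arbitrary joint strategy. No
  minimization is performed, so it is an equality, with the weighted square measuring the deviation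
  of the action from the feedback \<open>- y_vec\<close>.\<close>

lemma V_val_step:
  assumes x0: "x0 \<in> carrier_vec (state_dim G)"
    and u: "\<forall>i\<in>players G. \<forall>k<horizon G. u i k \<in> carrier_vec (act_dim G i)"
    and i: "i \<in> players G" and k: "k < horizon G"
    and mu: "mu i k \<in> carrier_vec (con_dim G i)"
    and ric: "RIC_solution G E i" and sym: "sym_mat (E i (Suc k))"
  defines "x \<equiv> state G x0 u k"
  shows "V_val G x0 E u mu i (Suc k)
      + 1/2 * (qform (Qmat G i k) x + 2 * (pvec G i k \<bullet> x)
               + (\<Sum>j\<in>players G. qform (Rmat G i j k) (u j k)))
    = V_val G x0 E u mu i k
      + 1/2 * qform (Ymat G E i k) (u i k + y_vec G x0 E u mu i k)
      + mu i k \<bullet> (Mmat G i k *\<^sub>v x + Nblock G i i k *\<^sub>v u i k + alpha G u i k + rvec G i k)"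
proof -
  let ?n = "state_dim G" and ?d = "act_dim G i" and ?c = "con_dim G i"
  let ?Y = "Ymat G E i k" and ?e = "e_vec G E u mu i (Suc k)"
  have A: "Amat G k \<in> carrier_mat ?n ?n" and B: "Bmat G i k \<in> carrier_mat ?n ?d"
    and M: "Mmat G i k \<in> carrier_mat ?c ?n" and r: "rvec G i k \<in> carrier_vec ?c"
    and Q: "Qmat G i k \<in> carrier_mat ?n ?n" and p: "pvec G i k \<in> carrier_vec ?n"
    and R: "Rmat G i i k \<in> carrier_mat ?d ?d" and symR: "sym_mat (Rmat G i i k)"
    using game i k by (auto simp: dgc_game_def Let_def)
  have N: "Nblock G i j k \<in> carrier_mat ?c (act_dim G j)" for j
    by (simp add: Nblock_def)
  have E: "E i (Suc k) \<in> carrier_mat ?n ?n" and invY: "invertible_mat ?Y"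
    and E0: "E i k = transpose_mat (Amat G k) * E i (Suc k) * Amat G k + Qmat G i k
      - transpose_mat (Amat G k) * E i (Suc k) * Bmat G i k * mat_inv ?Y
        * transpose_mat (Bmat G i k) * E i (Suc k) * Amat G k"
    using ric k by (auto simp: RIC_solution_def Let_def)
  have Y: "?Y \<in> carrier_mat ?d ?d"
    using B E R by (auto simp: Ymat_def)
  have x: "x \<in> carrier_vec ?n"
    unfolding x_def using state_carrier[OF x0 u] k by simp
  have e: "?e \<in> carrier_vec ?n"
    using e_vec_carrier[OF i] k by simp
  have uc: "u j k \<in> carrier_vec (act_dim G j)" if "j \<in> players G" for j
    using u k that by blast
  have Bu: "Bmat G j k *\<^sub>v u j k \<in> carrier_vec ?n" if "j \<in> players G" for j
    using game k that uc[OF that] by (intro mult_mat_vec_carrier[of _ _ "act_dim G j"]) (auto simp: dgc_game_def Let_def)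
  have eta: "eta G u i k \<in> carrier_vec ?n"
    unfolding eta_def state_sum_def using Bu by (intro finsum_vec_closed) auto
  have alpha: "alpha G u i k \<in> carrier_vec ?c"
    unfolding alpha_def con_sum_def using mult_mat_vec_carrier[OF N uc] by (intro finsum_vec_closed) auto
  have fin: "finite (players G)"
    by (simp add: players_def)
  have b_eq: "b_vec G E u mu i k = b_of G E u mu i k ?e"
    using k by (simp add: b_vec_def)
  have b: "b_vec G E u mu i k \<in> carrier_vec ?d"
    unfolding b_eq b_of_def using mat_inv(1)[OF Y invY] by (intro carrier_vecI) simp
  have x1: "state G x0 u (Suc k) = Amat G k *\<^sub>v x + (Bmat G i k *\<^sub>v u i k + eta G u i k)"
    using finsum_vec_remove[OF fin i Bu] by (simp add: x_def eta_def state_sum_def)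
  \<comment> \<open>Only player i's own control cost enters the completed square; the remaining sum
    is absorbed by the recursion for \<open>f_val\<close>.\<close>
  have Rsum: "(\<Sum>j\<in>players G. qform (Rmat G i j k) (u j k)) =
      qform (Rmat G i i k) (u i k) + (\<Sum>j\<in>players G - {i}. qform (Rmat G i j k) (u j k))"
    using fin i by (rule sum.remove)
  have e0: "e_vec G E u mu i k = transpose_mat (Amat G k) *\<^sub>v ?e
      + transpose_mat (Amat G k) *\<^sub>v (E i (Suc k) *\<^sub>v eta G u i k)
      - transpose_mat (Amat G k) *\<^sub>v (E i (Suc k) *\<^sub>v (Bmat G i k *\<^sub>v b_vec G E u mu i k))
      + pvec G i k - transpose_mat (Mmat G i k) *\<^sub>v mu i k"
    using k by (simp add: e_vec.simps[of G E u mu i k] Let_def b_eq)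
  \<comment> \<open>Rebracketed so that \<open>alpha\<close> plus \<open>rvec\<close> plays the role
    of \<open>a\<close> in \<open>complete_square\<close>, as it does in
    \<open>f_val\<close>.\<close>
  have assoc: "Mmat G i k *\<^sub>v x + Nblock G i i k *\<^sub>v u i k + alpha G u i k + rvec G i k =
      Mmat G i k *\<^sub>v x + Nblock G i i k *\<^sub>v u i k + (alpha G u i k + rvec G i k)"
    using M x N[of i] uc[OF i] alpha r by (intro assoc_add_vec[of _ ?c]) auto
  show ?thesis
    using complete_square[OF A B E M N Q R mat_inv(1)[OF Y invY] x eta e p uc[OF i] b mu
        add_carrier_vec[OF alpha r] sym symR Ymat_def mat_inv(2)[OF Y invY]
        b_of_eq[OF Y invY, of u mu ?e, folded b_eq] y_vec_def[of G x0 E u mu i k, folded x_def] E0 e0 x1]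
      f_val.simps[of G E u mu i k] k
    unfolding assoc Rsum by (simp add: V_val_def algebra_simps flip: x_def)
qed

end

theorem theorem1:
  fixes G :: dgc and x0 :: "real vec"
    and E :: "nat \<Rightarrow> nat \<Rightarrow> real mat"
    and xs :: "nat \<Rightarrow> real vec" and lam mu :: "nat \<Rightarrow> nat \<Rightarrow> real vec"
  assumes game: "dgc_game G"
    and x0: "x0 \<in> X0 G"
    and ric: "\<forall>i\<in>players G. RIC_solution G E i \<and> (\<forall>k\<le>horizon G. sym_mat (E i k))"
    and lcs: "LCS1_solution G x0 xs lam mu"
  shows "\<forall>u\<in>feasible G x0. \<forall>i\<in>players G.
    objective G x0 i u =
      V_val G x0 E u mu i 0
      + 1/2 * (\<Sum>k<horizon G. qform (Ymat G E i k) (u i k + y_vec G x0 E u mu i k))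
      + (\<Sum>k<horizon G. mu i k \<bullet>
           (Mmat G i k *\<^sub>v state G x0 u k + Nblock G i i k *\<^sub>v u i k + alpha G u i k + rvec G i k))"
proof (intro ballI)
  fix u i assume "u \<in> feasible G x0" and i: "i \<in> players G"
  then have u: "\<forall>i\<in>players G. \<forall>k<horizon G. u i k \<in> carrier_vec (act_dim G i)"
    by (simp add: feasible_def)
  have x0c: "x0 \<in> carrier_vec (state_dim G)"
    using x0 by (simp add: X0_def)
  have mu: "mu i k \<in> carrier_vec (con_dim G i)" if "k < horizon G" for k
    using lcs i that by (simp add: LCS1_solution_def Let_def)
  let ?V = "V_val G x0 E u mu i" and ?x = "state G x0 u"
  let ?g = "\<lambda>k. qform (Qmat G i k) (?x k) + 2 * (pvec G i k \<bullet> ?x k)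
    + (\<Sum>j\<in>players G. qform (Rmat G i j k) (u j k))"
  let ?q = "\<lambda>k. qform (Ymat G E i k) (u i k + y_vec G x0 E u mu i k)"
  let ?s = "\<lambda>k. mu i k \<bullet>
    (Mmat G i k *\<^sub>v ?x k + Nblock G i i k *\<^sub>v u i k + alpha G u i k + rvec G i k)"
  have step: "?V (Suc k) + 1/2 * ?g k = ?V k + 1/2 * ?q k + ?s k" if "k < horizon G" for k
    using V_val_step[OF game x0c u i that, of mu E] mu[OF that] ric i that by simp
  \<comment> \<open>Partial sums up to any \<open>k\<close> make the claim inductive; at
    \<open>k = horizon G\<close> the remaining value is the terminal one.\<close>
  have telescope: "?V k + 1/2 * (\<Sum>l<k. ?g l) = ?V 0 + 1/2 * (\<Sum>l<k. ?q l) + (\<Sum>l<k. ?s l)"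
    if "k \<le> horizon G" for k
    using that
  proof (induction k)
    case (Suc k)
    then show ?case using step[of k] by (simp add: algebra_simps)
  qed simp
  \<comment> \<open>At the horizon the recursions take their terminal branch: E becomes Q, e becomes
    p, and f vanishes.\<close>
  have "?V (horizon G) = 1/2 * qform (Qmat G i (horizon G)) (?x (horizon G))
      + pvec G i (horizon G) \<bullet> ?x (horizon G)"
    using ric i by (simp add: V_val_def RIC_solution_def e_vec.simps[of _ _ _ _ _ "horizon G"]
        f_val.simps[of _ _ _ _ _ "horizon G"])
  then show "objective G x0 i u = ?V 0 + 1/2 * (\<Sum>k<horizon G. ?q k) + (\<Sum>k<horizon G. ?s k)"
    using telescope[OF order_refl] by (simp add: objective_def Let_def)
qed

end
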